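(* Let $k \geq 0$ be an integer. Every $(2k+2)$-degenerate graph that has a maximal $(k+2)$-quasiplanar convex geometric representation has a cylindrical semi-bar $k$-visibility representation in which all semi-bars have different lengths.
   Context: A graph is $l$-degenerate if every subgraph has a vertex of degree at most $l$. A $(k+2)$-quasiplanar convex geometric representation of a graph is a drawing in the plane with vertices as points in convex position and edges as straight segments such that no $k+2$ edges are pairwise crossing; it is maximal if adding any further straight segment between two non-adjacent vertices creates $k+2$ pairwise crossing edges. A cylindrical semi-bar $k$-visibility representation of a graph $G=(V,E)$ is a collection $\{s_v\}_{v\in V}$ of pairwise disjoint segments (semi-bars) in $\mathbb{R}^3$ parallel to the $x$-axis with left endpoints on the circle $\{(0,y,z): y^2+z^2=1\}$, such that for all $a,b\in V$, $\{a,b\}\in E$ iff there is a circular arc on the surface of the cylinder $y^2+z^2=1$ lying in a plane parallel to the $yz$-plane which intersects $s_a$, $s_b$, and at most $k$ other semi-bars. *)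

theory Defs
  imports "HOL-Analysis.Analysis"
begin

section \<open>Finite simple graphs and degeneracy\<close>

definition simple_graph :: "'a set \<Rightarrow> 'a set set \<Rightarrow> bool" where
  "simple_graph V E \<longleftrightarrow> finite V \<and> (\<forall>e\<in>E. e \<subseteq> V \<and> card e = 2)"

definition graph_degree :: "'a set set \<Rightarrow> 'a \<Rightarrow> nat" where
  "graph_degree E v = card {e \<in> E. v \<in> e}"

definition subgraph_of :: "'a set \<Rightarrow> 'a set set \<Rightarrow> 'a set \<Rightarrow> 'a set set \<Rightarrow> bool" where
  "subgraph_of V' E' V E \<longleftrightarrow> V' \<subseteq> V \<and> E' \<subseteq> E \<and> (\<forall>e\<in>E'. e \<subseteq> V')"

definition degenerate_graph :: "nat \<Rightarrow> 'a set \<Rightarrow> 'a set set \<Rightarrow> bool" where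
  "degenerate_graph l V E \<longleftrightarrow>
     (\<forall>V' E'. subgraph_of V' E' V E \<and> V' \<noteq> {} \<longrightarrow> (\<exists>v\<in>V'. graph_degree E' v \<le> l))"

section \<open>Convex geometric representations\<close>

definition convex_position :: "(real^2) set \<Rightarrow> bool" where
  "convex_position S \<longleftrightarrow> (\<forall>x\<in>S. x \<notin> convex hull (S - {x}))"

text \<open>Edges cross when the drawn segments meet in a point interior to both. For points in
  convex position, distinct edges with a common endpoint therefore never cross.\<close>

definition crossing :: "('a \<Rightarrow> real^2) \<Rightarrow> 'a set \<Rightarrow> 'a set \<Rightarrow> bool" where
  "crossing p e f \<longleftrightarrow> e \<noteq> f \<and>
     (\<exists>a b c d. e = {a, b} \<and> f = {c, d} \<and>
        open_segment (p a) (p b) \<inter> open_segment (p c) (p d) \<noteq> {})"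

definition has_pairwise_crossing :: "nat \<Rightarrow> ('a \<Rightarrow> real^2) \<Rightarrow> 'a set set \<Rightarrow> bool" where
  "has_pairwise_crossing r p E \<longleftrightarrow>
     (\<exists>F. F \<subseteq> E \<and> finite F \<and> card F = r \<and> pairwise (crossing p) F)"

definition quasiplanar_convex_rep ::
    "nat \<Rightarrow> 'a set \<Rightarrow> 'a set set \<Rightarrow> ('a \<Rightarrow> real^2) \<Rightarrow> bool" where
  "quasiplanar_convex_rep r V E p \<longleftrightarrow>
     inj_on p V \<and> convex_position (p ` V) \<and> \<not> has_pairwise_crossing r p E"

definition maximal_quasiplanar_convex_rep ::
    "nat \<Rightarrow> 'a set \<Rightarrow> 'a set set \<Rightarrow> ('a \<Rightarrow> real^2) \<Rightarrow> bool" where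
  "maximal_quasiplanar_convex_rep r V E p \<longleftrightarrow>
     quasiplanar_convex_rep r V E p \<and>
     (\<forall>u\<in>V. \<forall>v\<in>V. u \<noteq> v \<and> {u, v} \<notin> E \<longrightarrow>
        has_pairwise_crossing r p (insert {u, v} E))"

section \<open>Cylindrical semi-bar visibility representations\<close>

definition base_circle :: "(real^3) set" where
  "base_circle = {vector [0, y, z] | y z. y\<^sup>2 + z\<^sup>2 = 1}"

definition semi_bar :: "real^3 \<Rightarrow> real \<Rightarrow> (real^3) set" where
  "semi_bar q l = closed_segment q (q + l *\<^sub>R vector [1, 0, 0])"

text \<open>The full circle is included; for finitely many semi-bars it may be replaced by a proper
  arc meeting the same ones, so this does not affect visibility.\<close>

definition circular_arc :: "(real^3) set \<Rightarrow> bool" where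
  "circular_arc A \<longleftrightarrow>
     (\<exists>c \<alpha> \<beta>. \<alpha> < \<beta> \<and> \<beta> \<le> \<alpha> + 2 * pi \<and> A = (\<lambda>t. vector [c, cos t, sin t]) ` {\<alpha>..\<beta>})"

definition visible :: "nat \<Rightarrow> 'a set \<Rightarrow> ('a \<Rightarrow> (real^3) set) \<Rightarrow> 'a \<Rightarrow> 'a \<Rightarrow> bool" where
  "visible k V s a b \<longleftrightarrow>
     (\<exists>A. circular_arc A \<and> A \<inter> s a \<noteq> {} \<and> A \<inter> s b \<noteq> {} \<and>
        card {v \<in> V - {a, b}. A \<inter> s v \<noteq> {}} \<le> k)"

text \<open>\<open>q v\<close> is the left endpoint and \<open>len v\<close> the length of the semi-bar of the vertex \<open>v\<close>.\<close>

definition cyl_semi_bar_visibility_rep ::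
    "nat \<Rightarrow> 'a set \<Rightarrow> 'a set set \<Rightarrow> ('a \<Rightarrow> real^3) \<Rightarrow> ('a \<Rightarrow> real) \<Rightarrow> bool" where
  "cyl_semi_bar_visibility_rep k V E q len \<longleftrightarrow>
     (let s = (\<lambda>v. semi_bar (q v) (len v)) in
        (\<forall>v\<in>V. q v \<in> base_circle \<and> len v > 0) \<and>
        pairwise (\<lambda>u v. disjnt (s u) (s v)) V \<and>
        (\<forall>a\<in>V. \<forall>b\<in>V. a \<noteq> b \<longrightarrow> ({a, b} \<in> E \<longleftrightarrow> visible k V s a b)))"

end

theory Submission
  imports Defs
begin

text \<open>Call two vertices near if on one side at most \<open>k\<close> vertices lie between them in the cyclic order
  of the drawing. Every one of \<open>k + 2\<close> pairwise crossing edges has at least \<open>k + 1\<close> vertices on both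
  sides, so by maximality near vertices are adjacent. Hence a vertex \<open>v\<close> of degree at most \<open>2k + 2\<close> is
  adjacent precisely to the vertices near it. None of its edges occurs in a family of \<open>k + 2\<close>
  pairwise crossing edges, so removing \<open>v\<close> preserves maximality. Removing vertices of
  degree at most \<open>2k + 2\<close> one after the other, with increasing lengths, we obtain an ordering in which
  \<open>v\<close> is adjacent to a longer \<open>w\<close> iff they are near among the vertices at least as long as \<open>v\<close>.
  This is visibility, if the semi-bars are placed in the cyclic order of the drawing: an arc
  joining the two sees the fewest other semi-bars at the tip of the shorter one.\<close>

section \<open>The cyclic order of points in convex position\<close>

text \<open>Twice the signed area of the triangle: positive iff \<open>x\<close>, \<open>y\<close>,
  \<open>z\<close> are in counterclockwise order.\<close>

definition orient :: "real^2 \<Rightarrow> real^2 \<Rightarrow> real^2 \<Rightarrow> real" where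
  "orient x y z = (y$1 - x$1) * (z$2 - x$2) - (y$2 - x$2) * (z$1 - x$1)"

lemma vec2_eq_iff: "(x :: real^2) = y \<longleftrightarrow> x$1 = y$1 \<and> x$2 = y$2"
  by (simp add: vec_eq_iff forall_2)

lemma orient_combination:
  assumes "u + v = 1"
  shows "orient a b (u *\<^sub>R c + v *\<^sub>R d) = u * orient a b c + v * orient a b d"
proof -
  have u: "u = 1 - v" using assms by simp
  show ?thesis unfolding u orient_def by (simp add: algebra_simps)
qed

lemma convex_position_triangle:
  assumes "convex_position S" "{p, a, c} \<subseteq> S" "b \<in> S" "b \<notin> {p, a, c}"
  shows "b \<notin> convex hull {p, a, c}"
  using assms hull_mono[of "{p, a, c}" "S - {b}" convex]
  unfolding convex_position_def by blast

text \<open>Seen from one of the points, the others lie in an open half-plane \<open>w \<bullet> (x - q) > 0\<close>, where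
  they can be sorted by slope relative to \<open>w\<close>.\<close>

lemma convex_position_order:
  fixes S :: "(real^2) set"
  assumes "finite S" "convex_position S"
  shows "\<exists>f :: real^2 \<Rightarrow> real. inj_on f S \<and>
    (\<forall>x\<in>S. \<forall>y\<in>S. \<forall>z\<in>S. f x < f y \<and> f y < f z \<longrightarrow> orient x y z > 0)"
proof (cases "S = {}")
  case False
  then obtain q where q: "q \<in> S" by blast
  have "q \<notin> convex hull (S - {q})"
    using assms(2) q unfolding convex_position_def by blast
  moreover have "closed (convex hull (S - {q}))"
    using assms(1) by (simp add: compact_imp_closed finite_imp_compact_convex_hull)
  ultimately obtain w b where wb: "w \<bullet> q < b" "\<forall>x\<in>convex hull (S - {q}). w \<bullet> x > b"
    using separating_hyperplane_closed_point[OF convex_convex_hull] by metis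
  \<comment> \<open>In the orthogonal frame of \<open>w\<close> and \<open>w\<close> turned by a
    right angle, with origin \<open>q\<close>, \<open>h x\<close> is the first coordinate of
    \<open>x\<close> up to scaling and \<open>g x\<close> the quotient of the second by the
    first.\<close>
  define h where "h x = w$1 * (x$1 - q$1) + w$2 * (x$2 - q$2)" for x :: "real^2"
  define g where "g x = (w$1 * (x$2 - q$2) - w$2 * (x$1 - q$1)) / h x" for x :: "real^2"
  have h_pos: "h x > 0" if "x \<in> S - {q}" for x
  proof -
    have "w \<bullet> x > b" using wb(2) that by (simp add: hull_inc)
    then have "w \<bullet> x > w \<bullet> q" using wb(1) by simp
    then show ?thesis by (simp add: h_def inner_vec_def sum_2 algebra_simps)
  qed
  have w_ne: "(w$1)\<^sup>2 + (w$2)\<^sup>2 > 0" if "x \<in> S - {q}" for x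
  proof -
    have "w$1 \<noteq> 0 \<or> w$2 \<noteq> 0" using h_pos[OF that] by (auto simp: h_def)
    then show ?thesis by (simp add: sum_power2_gt_zero_iff)
  qed
  \<comment> \<open>Passing to that frame multiplies the determinant \<open>orient q x y\<close> by
    the squared norm of \<open>w\<close>.\<close>
  have orient_g: "((w$1)\<^sup>2 + (w$2)\<^sup>2) * orient q x y = h x * h y * (g y - g x)"
    if "x \<in> S - {q}" "y \<in> S - {q}" for x y
  proof -
    have "h x * h y * (g y - g x) = h x * (h y * g y) - h y * (h x * g x)"
      by (simp add: algebra_simps)
    also have "h y * g y = w$1 * (y$2 - q$2) - w$2 * (y$1 - q$1)"
      using h_pos[OF that(2)] by (simp add: g_def)
    also have "h x * g x = w$1 * (x$2 - q$2) - w$2 * (x$1 - q$1)"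
      using h_pos[OF that(1)] by (simp add: g_def)
    finally show ?thesis
      unfolding orient_def h_def by (simp add: algebra_simps power2_eq_square)
  qed
  have orient_pos: "orient q x y > 0" if "x \<in> S - {q}" "y \<in> S - {q}" "g x < g y" for x y
  proof -
    have "h x * h y * (g y - g x) > 0" using h_pos that by simp
    then have "((w$1)\<^sup>2 + (w$2)\<^sup>2) * orient q x y > 0" using orient_g that by simp
    then show ?thesis using w_ne[OF that(1)] by (simp add: zero_less_mult_iff)
  qed
  \<comment> \<open>Equal slopes mean a common ray from \<open>q\<close>. The point with smaller
    \<open>h\<close> would then lie on the segment from \<open>q\<close> to the other, which is the
    degenerate triangle \<open>{q, y, y}\<close>.\<close>
  have wlog_h: "x = y" if "x \<in> S - {q}" "y \<in> S - {q}" "g x = g y" "h x \<le> h y" for x y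
  proof (rule ccontr)
    assume "x \<noteq> y"
    have "orient q x y = 0"
      using orient_g[OF that(1,2)] that(3) mult_eq_0_iff less_irrefl w_ne[OF that(1)]
      by (metis diff_self mult_zero_right)
    then have par: "(x$1 - q$1) * (y$2 - q$2) = (x$2 - q$2) * (y$1 - q$1)"
      by (simp add: orient_def)
    define s where "s = h x / h y"
    have s: "0 \<le> s" "s \<le> 1" "s * h y = h x"
      using h_pos[OF that(1)] h_pos[OF that(2)] that(4) by (simp_all add: s_def)
    have "h y * (x$1 - q$1) = h x * (y$1 - q$1)" "h y * (x$2 - q$2) = h x * (y$2 - q$2)"
      using par unfolding h_def by algebra+
    then have "h y * (x$1 - q$1) = h y * (s * (y$1 - q$1))"
      "h y * (x$2 - q$2) = h y * (s * (y$2 - q$2))"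
      using s(3) by (metis mult.assoc mult.commute)+
    then have "x$1 - q$1 = s * (y$1 - q$1)" "x$2 - q$2 = s * (y$2 - q$2)"
      using h_pos[OF that(2)] by simp_all
    then have "x = (1 - s) *\<^sub>R q + s *\<^sub>R y + 0 *\<^sub>R y"
      by (simp add: vec2_eq_iff algebra_simps)
    then have "x \<in> convex hull {q, y, y}"
      unfolding convex_hull_3 using s(1,2)
      by (intro CollectI exI[of _ "1 - s"] exI[of _ s] exI[of _ 0]) auto
    then show False
      using convex_position_triangle[OF assms(2), of q y y x] q that \<open>x \<noteq> y\<close> by auto
  qed
  have g_inj: "x = y" if "x \<in> S - {q}" "y \<in> S - {q}" "g x = g y" for x y
    using wlog_h[of x y] wlog_h[of y x] that by (metis linear)
  have orient_triple: "orient x y z > 0"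
    if xyz: "x \<in> S - {q}" "y \<in> S - {q}" "z \<in> S - {q}" "g x < g y" "g y < g z" for x y z
  proof (rule ccontr)
    assume neg: "\<not> orient x y z > 0"
    define D where "D = orient q x z"
    have D: "D > 0" "orient q y z > 0" "orient q x y > 0"
      using orient_pos xyz unfolding D_def by auto
    \<comment> \<open>Cramer's rule: these are the barycentric coordinates of \<open>y\<close> at
      \<open>x\<close> and \<open>z\<close> in the triangle \<open>q\<close>, \<open>x\<close>,
      \<open>z\<close>. The assumption \<open>neg\<close> makes the coordinate at \<open>q\<close>
      non-negative, so \<open>y\<close> would lie in that triangle.\<close>
    define u v where "u = orient q y z / D" and "v = orient q x y / D"
    have uv: "u > 0" "v > 0" using D by (simp_all add: u_def v_def)
    have "orient x y z = orient q x y + orient q y z - D"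
      unfolding D_def orient_def by (simp add: algebra_simps)
    then have "u + v \<le> 1"
      using neg D unfolding u_def v_def by (simp add: field_simps)
    have "D * (y$1 - q$1) = orient q y z * (x$1 - q$1) + orient q x y * (z$1 - q$1)"
      "D * (y$2 - q$2) = orient q y z * (x$2 - q$2) + orient q x y * (z$2 - q$2)"
      unfolding D_def orient_def by algebra+
    moreover have "orient q y z = D * u" "orient q x y = D * v"
      using D(1) by (simp_all add: u_def v_def)
    ultimately have "D * (y$1 - q$1) = D * (u * (x$1 - q$1) + v * (z$1 - q$1))"
      "D * (y$2 - q$2) = D * (u * (x$2 - q$2) + v * (z$2 - q$2))"
      by (simp_all only: distrib_left mult.assoc)
    then have "y$1 - q$1 = u * (x$1 - q$1) + v * (z$1 - q$1)"
      "y$2 - q$2 = u * (x$2 - q$2) + v * (z$2 - q$2)"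
      using D(1) by simp_all
    then have "y = (1 - u - v) *\<^sub>R q + u *\<^sub>R x + v *\<^sub>R z"
      by (simp add: vec2_eq_iff algebra_simps)
    then have "y \<in> convex hull {q, x, z}"
      unfolding convex_hull_3 using uv \<open>u + v \<le> 1\<close>
      by (intro CollectI exI[of _ "1 - u - v"] exI[of _ u] exI[of _ v]) auto
    then show False
      using convex_position_triangle[OF assms(2), of q x z y] q xyz by auto
  qed
  \<comment> \<open>A value below all slopes, so that \<open>q\<close> comes first; triples
    beginning with \<open>q\<close> are covered by \<open>orient_pos\<close>.\<close>
  define m where "m = Min (insert 0 (g ` S)) - 1"
  have m: "m < g x" if "x \<in> S" for x
  proof -
    have "Min (insert 0 (g ` S)) \<le> g x" using assms(1) that by (intro Min_le) auto
    then show ?thesis by (simp add: m_def)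
  qed
  define f where "f x = (if x = q then m else g x)" for x
  have "inj_on f S"
    using m g_inj by (force simp: inj_on_def f_def)
  moreover have "orient x y z > 0"
    if "x \<in> S" "y \<in> S" "z \<in> S" "f x < f y" "f y < f z" for x y z
  proof -
    have "y \<noteq> q" "z \<noteq> q" using that m[of x] m[of y] by (auto simp: f_def split: if_splits)
    then show ?thesis
      using that orient_pos orient_triple by (cases "x = q") (auto simp: f_def)
  qed
  ultimately show ?thesis by blast
qed auto

text \<open>The line through \<open>p a\<close> and \<open>p b\<close> has the vertices between
  \<open>a\<close> and \<open>b\<close> strictly on its right and all others strictly on its left. A
  crossing point lies on this line and is a proper convex combination of \<open>p c\<close> and
  \<open>p d\<close>, so these two lie on opposite sides.\<close>

lemma crossing_interleaved:
  fixes p :: "'a \<Rightarrow> real^2" and \<theta> :: "'a \<Rightarrow> real"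
  assumes inj: "inj_on \<theta> V"
    and ccw: "\<And>x y z. x \<in> V \<Longrightarrow> y \<in> V \<Longrightarrow> z \<in> V \<Longrightarrow> \<theta> x < \<theta> y \<Longrightarrow> \<theta> y < \<theta> z \<Longrightarrow>
      orient (p x) (p y) (p z) > 0"
    and cross: "crossing p e f" and sub: "e \<subseteq> V" "f \<subseteq> V" and f2: "card f = 2"
    and e: "e = {a, b}" "\<theta> a < \<theta> b"
  shows "\<exists>c d. f = {c, d} \<and> \<theta> a < \<theta> c \<and> \<theta> c < \<theta> b \<and> (\<theta> d < \<theta> a \<or> \<theta> b < \<theta> d)"
proof -
  obtain a' b' c d x where *: "e = {a', b'}" "f = {c, d}"
    "x \<in> open_segment (p a') (p b')" "x \<in> open_segment (p c) (p d)" "e \<noteq> f"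
    using cross unfolding crossing_def by blast
  have x_ab: "x \<in> open_segment (p a) (p b)"
    using *(1,3) e by (auto simp: doubleton_eq_iff open_segment_commute)
  have V: "a \<in> V" "b \<in> V" "c \<in> V" "d \<in> V" using sub e *(2) by auto
  have "c \<noteq> d" using f2 *(2) by auto
  define g where "g z = orient (p a) (p b) z" for z
  have "g (p a) = 0" "g (p b) = 0" by (simp_all add: g_def orient_def)
  then have "g x = 0"
    using x_ab orient_combination unfolding in_segment g_def
    by (metis add.right_neutral diff_add_cancel mult_zero_right)
  obtain u where u: "0 < u" "u < 1" "x = (1 - u) *\<^sub>R p c + u *\<^sub>R p d"
    using *(4) unfolding in_segment by blast
  have sum0: "(1 - u) * g (p c) + u * g (p d) = 0"
    using \<open>g x = 0\<close> orient_combination[of "1 - u" u] u(3) unfolding g_def by simp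
  have outer: "g (p z) > 0" if "z \<in> V" "\<theta> z < \<theta> a \<or> \<theta> b < \<theta> z" for z
  proof -
    have "g (p z) = orient (p z) (p a) (p b)"
      unfolding g_def orient_def by (simp add: algebra_simps)
    then show ?thesis using that ccw[of z a b] ccw[of a b z] V e(2) by (auto simp: g_def)
  qed
  have inner: "g (p z) < 0" if "z \<in> V" "\<theta> a < \<theta> z" "\<theta> z < \<theta> b" for z
  proof -
    have "g (p z) = - orient (p a) (p z) (p b)"
      unfolding g_def orient_def by (simp add: algebra_simps)
    then show ?thesis using that ccw[of a z b] V by auto
  qed
  have zero: "z = a \<or> z = b" if "z \<in> V" "g (p z) = 0" for z
  proof (rule ccontr)
    assume "\<not> ?thesis"
    then have "\<theta> z \<noteq> \<theta> a" "\<theta> z \<noteq> \<theta> b" using inj V that(1) by (auto dest: inj_onD)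
    then show False using inner[OF that(1)] outer[OF that(1)] that(2) by fastforce
  qed
  have inner_iff: "\<theta> a < \<theta> z \<and> \<theta> z < \<theta> b" if "z \<in> V" "g (p z) < 0" for z
  proof -
    have "z \<noteq> a" "z \<noteq> b" using that \<open>g (p a) = 0\<close> \<open>g (p b) = 0\<close> by auto
    then have "\<theta> z \<noteq> \<theta> a" "\<theta> z \<noteq> \<theta> b" using inj V that(1) by (auto dest: inj_onD)
    then show ?thesis using outer[OF that(1)] that(2) by fastforce
  qed
  have outer_iff: "\<theta> z < \<theta> a \<or> \<theta> b < \<theta> z" if "z \<in> V" "g (p z) > 0" for z
  proof -
    have "z \<noteq> a" "z \<noteq> b" using that \<open>g (p a) = 0\<close> \<open>g (p b) = 0\<close> by auto
    then have "\<theta> z \<noteq> \<theta> a" "\<theta> z \<noteq> \<theta> b" using inj V that(1) by (auto dest: inj_onD)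
    then show ?thesis using inner[OF that(1)] that(2) by fastforce
  qed
  \<comment> \<open>If both values vanished, \<open>c\<close> and \<open>d\<close> would be
    \<open>a\<close> and \<open>b\<close>, and the two edges would coincide.\<close>
  have "g (p c) \<noteq> 0 \<or> g (p d) \<noteq> 0"
    using zero[of c] zero[of d] V \<open>c \<noteq> d\<close> *(2,5) e(1) by auto
  then have "g (p c) < 0 \<and> 0 < g (p d) \<or> g (p d) < 0 \<and> 0 < g (p c)"
  proof -
    consider "g (p c) < 0" | "g (p c) = 0" | "g (p c) > 0" by linarith
    then show ?thesis
    proof cases
      case 1
      then have "(1 - u) * g (p c) < 0" using u(2) by (simp add: mult_less_0_iff)
      then have "u * g (p d) > 0" using sum0 by linarith
      then show ?thesis using 1 u(1) by (simp add: zero_less_mult_iff)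
    next
      case 2
      then show ?thesis using sum0 u(1) \<open>g (p c) \<noteq> 0 \<or> g (p d) \<noteq> 0\<close> by simp
    next
      case 3
      then have "(1 - u) * g (p c) > 0" using u(2) by simp
      then have "u * g (p d) < 0" using sum0 by linarith
      then show ?thesis using 3 u(1) by (simp add: mult_less_0_iff)
    qed
  qed
  then show ?thesis
    using inner_iff outer_iff V *(2) by (metis insert_commute)
qed

section \<open>Crossing families and elimination of vertices\<close>

text \<open>\<open>\<rho> a b\<close> is the angle by which one turns from \<open>a\<close> to \<open>b\<close>, so \<open>near\<close> says that at most \<open>k\<close>
  vertices of \<open>W\<close> lie strictly between \<open>a\<close> and \<open>b\<close> on one of the two sides.\<close>

definition near :: "nat \<Rightarrow> ('a \<Rightarrow> 'a \<Rightarrow> real) \<Rightarrow> 'a set \<Rightarrow> 'a \<Rightarrow> 'a \<Rightarrow> bool" where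
  "near k \<rho> W a b \<longleftrightarrow>
     card {y \<in> W. 0 < \<rho> a y \<and> \<rho> a y < \<rho> a b} \<le> k \<or> card {y \<in> W. \<rho> a b < \<rho> a y} \<le> k"

text \<open>Take an element outside the set with \<open>r\<close> minimal: at least \<open>n\<close>
  elements lie below it, and all of them belong to the set. Applied to angles, this yields the
  vertices closest to a given one on one side.\<close>

lemma card_low_rank:
  fixes r :: "'a \<Rightarrow> real"
  assumes "finite X" "n \<le> card X"
  shows "n \<le> card {x \<in> X. card {y \<in> X. r y < r x} < n}" (is "n \<le> card ?T")
proof (cases "X - ?T = {}")
  case True
  then have "?T = X" by blast
  then show ?thesis using assms by simp
next
  case False
  then obtain z where z: "z \<in> X - ?T" "\<And>y. y \<in> X - ?T \<Longrightarrow> r z \<le> r y"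
    using assms(1) ex_min_if_finite[of "r ` (X - ?T)"]
    by (metis (no_types, lifting) arg_min_if_finite(1) arg_min_least finite_Diff)
  have "{y \<in> X. r y < r z} \<subseteq> ?T" using z(2) by force
  then have "card {y \<in> X. r y < r z} \<le> card ?T" using assms(1) by (intro card_mono) auto
  then show ?thesis using z(1) by auto
qed

section \<open>Saturation and crossing families in a cyclic order\<close>

definition induced_edges :: "'a set set \<Rightarrow> 'a set \<Rightarrow> 'a set set" where
  "induced_edges E W = {e \<in> E. e \<subseteq> W}"

text \<open>Maximality relative to \<open>W\<close>: the witnessing edges must stay inside
  \<open>W\<close>, which lets the property be handed down as vertices are deleted.\<close>

definition saturated :: "nat \<Rightarrow> ('a set \<Rightarrow> 'a set \<Rightarrow> bool) \<Rightarrow> 'a set set \<Rightarrow> 'a set \<Rightarrow> bool" where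
  "saturated k X E W \<longleftrightarrow>
     (\<forall>u\<in>W. \<forall>v\<in>W. u \<noteq> v \<and> {u, v} \<notin> E \<longrightarrow>
        (\<exists>F \<subseteq> induced_edges E W. card F = k + 1 \<and> pairwise X (insert {u, v} F)))"

text \<open>Abstracts from the drawing: all that is kept of a crossing is that the endpoints
  alternate, as seen from either endpoint of the first edge.\<close>

locale cyclic_crossing =
  fixes V :: "'a set" and E :: "'a set set" and \<rho> :: "'a \<Rightarrow> 'a \<Rightarrow> real"
    and X :: "'a set \<Rightarrow> 'a set \<Rightarrow> bool"
  assumes graph: "simple_graph V E"
    and rho_self: "\<rho> a a = 0"
    and cross: "\<lbrakk>X e f; e \<subseteq> V; f \<subseteq> V; card e = 2; card f = 2; e = {a, b}\<rbrakk>
      \<Longrightarrow> \<exists>c d. f = {c, d} \<and> 0 < \<rho> a c \<and> \<rho> a c < \<rho> a b \<and> \<rho> a b < \<rho> a d"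
begin

lemma edgeD: "e \<in> E \<Longrightarrow> e \<subseteq> V" "e \<in> E \<Longrightarrow> card e = 2"
  using graph by (auto simp: simple_graph_def)

lemma cross_disjoint:
  assumes "X e f" "e \<subseteq> V" "f \<subseteq> V" "card e = 2" "card f = 2"
  shows "e \<inter> f = {}"
proof -
  obtain a b where e: "e = {a, b}" using assms(4) by (auto simp: card_2_iff)
  obtain c d where "f = {c, d}" "0 < \<rho> a c" "\<rho> a c < \<rho> a b" "\<rho> a b < \<rho> a d"
    using cross[OF assms e] by blast
  then show ?thesis using e rho_self[of a] by auto
qed

text \<open>Each of the \<open>k + 1\<close> edges crossing \<open>{a, b}\<close> has an endpoint on either side, and edges that
  cross each other do not share an endpoint.\<close>

lemma crossing_family_not_near:
  assumes W: "W \<subseteq> V" "a \<in> W" "b \<in> W" "a \<noteq> b"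
    and F: "\<And>f. f \<in> F \<Longrightarrow> f \<subseteq> W \<and> card f = 2" "card F = k + 1"
    and ab: "{a, b} \<notin> F" and pw: "pairwise X (insert {a, b} F)"
  shows "\<not> near k \<rho> W a b"
proof -
  have finW: "finite W" using graph W(1) by (auto simp: simple_graph_def intro: finite_subset)
  have "\<forall>f\<in>F. \<exists>c d. f = {c, d} \<and> 0 < \<rho> a c \<and> \<rho> a c < \<rho> a b \<and> \<rho> a b < \<rho> a d"
  proof
    fix f assume f: "f \<in> F"
    then have "X {a, b} f" using pw ab unfolding pairwise_def by auto
    then show "\<exists>c d. f = {c, d} \<and> 0 < \<rho> a c \<and> \<rho> a c < \<rho> a b \<and> \<rho> a b < \<rho> a d"
      using W F(1)[OF f] by (intro cross[of "{a, b}"]) auto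
  qed
  then obtain c d where cd: "\<And>f. f \<in> F \<Longrightarrow>
      f = {c f, d f} \<and> 0 < \<rho> a (c f) \<and> \<rho> a (c f) < \<rho> a b \<and> \<rho> a b < \<rho> a (d f)"
    by metis
  have share: "e = f" if "e \<in> F" "f \<in> F" "e \<inter> f \<noteq> {}" for e f
  proof (rule ccontr)
    assume "e \<noteq> f"
    then have "X e f" using pw that unfolding pairwise_def by simp
    then show False
      using cross_disjoint[of e f] F(1)[OF that(1)] F(1)[OF that(2)] W(1) that(3) by auto
  qed
  have cd_mem: "c f \<in> f" "d f \<in> f" if "f \<in> F" for f using cd[OF that] by auto
  have "inj_on c F" "inj_on d F"
    by (rule inj_onI, rule share, assumption+, metis cd_mem disjoint_iff)+
  have "c ` F \<subseteq> {y \<in> W. 0 < \<rho> a y \<and> \<rho> a y < \<rho> a b}" "d ` F \<subseteq> {y \<in> W. \<rho> a b < \<rho> a y}"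
    using cd cd_mem F(1) by blast+
  then have "card F \<le> card {y \<in> W. 0 < \<rho> a y \<and> \<rho> a y < \<rho> a b}"
    "card F \<le> card {y \<in> W. \<rho> a b < \<rho> a y}"
    using finW by (auto intro: card_inj_on_le[OF \<open>inj_on c F\<close>] card_inj_on_le[OF \<open>inj_on d F\<close>])
  then show ?thesis using F(2) by (simp add: near_def)
qed

lemma near_adjacent:
  assumes "W \<subseteq> V" "saturated k X E W" "a \<in> W" "b \<in> W" "a \<noteq> b" "near k \<rho> W a b"
  shows "{a, b} \<in> E"
proof (rule ccontr)
  assume ab: "{a, b} \<notin> E"
  then obtain F where "F \<subseteq> induced_edges E W" "card F = k + 1" "pairwise X (insert {a, b} F)"
    using assms unfolding saturated_def by blast
  moreover have "f \<subseteq> W \<and> card f = 2" if "f \<in> F" for f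
    using \<open>F \<subseteq> induced_edges E W\<close> that edgeD by (auto simp: induced_edges_def)
  moreover have "{a, b} \<notin> F"
    using \<open>F \<subseteq> induced_edges E W\<close> ab by (auto simp: induced_edges_def)
  ultimately show False
    using crossing_family_not_near[of W a b F k] assms by blast
qed

text \<open>If a neighbour \<open>u\<close> were not near, each side of the edge would contain at
  least \<open>k + 1\<close> vertices. The \<open>k + 1\<close> of them closest to \<open>v\<close>
  on each side are near \<open>v\<close> and hence adjacent to it; together with \<open>u\<close>
  these are \<open>2 * k + 3\<close> neighbours.\<close>

lemma low_degree_near:
  assumes W: "W \<subseteq> V" "saturated k X E W" and v: "v \<in> W"
    and deg: "graph_degree (induced_edges E W) v \<le> 2 * k + 2"
    and u: "u \<in> W" "u \<noteq> v" "{v, u} \<in> E"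
  shows "near k \<rho> W v u"
proof (rule ccontr)
  assume far: "\<not> near k \<rho> W v u"
  have fin: "finite W" using graph W(1) by (auto simp: simple_graph_def intro: finite_subset)
  define C where "C = {y \<in> W. 0 < \<rho> v y \<and> \<rho> v y < \<rho> v u}"
  define D where "D = {y \<in> W. \<rho> v u < \<rho> v y}"
  define C' where "C' = {x \<in> C. card {y \<in> C. \<rho> v y < \<rho> v x} < k + 1}"
  \<comment> \<open>The negated angle ranks the vertices of this side by closeness to
    \<open>v\<close>, going round in the other direction.\<close>
  define D' where "D' = {x \<in> D. card {y \<in> D. - \<rho> v y < - \<rho> v x} < k + 1}"
  have cards: "k + 1 \<le> card C" "k + 1 \<le> card D"
    using far by (auto simp: near_def C_def D_def)
  have finCD: "finite C" "finite D" using fin by (auto simp: C_def D_def)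
  have pos: "0 < \<rho> v u"
  proof -
    have "C \<noteq> {}" using cards(1) by auto
    then show ?thesis by (auto simp: C_def)
  qed
  have C': "k + 1 \<le> card C'" "k + 1 \<le> card D'"
    unfolding C'_def D'_def using cards finCD
    by (auto intro: card_low_rank[of _ "k+1" "\<rho> v", simplified]
        card_low_rank[of _ "k+1" "\<lambda>x. - \<rho> v x", simplified])
  have near_C': "near k \<rho> W v x" if "x \<in> C'" for x
  proof -
    have "{y \<in> W. 0 < \<rho> v y \<and> \<rho> v y < \<rho> v x} = {y \<in> C. \<rho> v y < \<rho> v x}"
      using that by (auto simp: C'_def C_def)
    then show ?thesis using that by (simp add: near_def C'_def)
  qed
  have near_D': "near k \<rho> W v x" if "x \<in> D'" for x
  proof -
    have "{y \<in> W. \<rho> v x < \<rho> v y} = {y \<in> D. - \<rho> v y < - \<rho> v x}"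
      using that by (auto simp: D'_def D_def)
    then show ?thesis using that by (simp add: near_def D'_def)
  qed
  define N where "N = insert u (C' \<union> D')"
  have "v \<notin> C'" "v \<notin> D'" using pos rho_self[of v] by (auto simp: C'_def C_def D'_def D_def)
  then have N: "N \<subseteq> W" "v \<notin> N"
    using u by (auto simp: N_def C'_def C_def D'_def D_def)
  have N_adj: "{v, x} \<in> E" if "x \<in> N" for x
    using that near_adjacent[OF W v, of x] near_C' near_D' u N unfolding N_def by blast
  have fin': "finite C'" "finite D'" using finCD by (auto simp: C'_def D'_def)
  have "C' \<inter> D' = {}" "u \<notin> C' \<union> D'" by (auto simp: C'_def C_def D'_def D_def)
  then have "card N = 1 + card C' + card D'"
    using fin' by (simp add: N_def card_Un_disjoint)
  moreover have "card N \<le> card {e \<in> induced_edges E W. v \<in> e}"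
  proof (rule card_inj_on_le)
    show "inj_on (\<lambda>x. {v, x}) N" by (auto simp: inj_on_def doubleton_eq_iff)
    show "(\<lambda>x. {v, x}) ` N \<subseteq> {e \<in> induced_edges E W. v \<in> e}"
      using N_adj N v by (auto simp: induced_edges_def)
    have "induced_edges E W \<subseteq> Pow W" by (auto simp: induced_edges_def)
    then show "finite {e \<in> induced_edges E W. v \<in> e}"
      using fin by (auto intro: finite_subset)
  qed
  ultimately show False using deg C' by (simp add: graph_degree_def)
qed

text \<open>An edge between near vertices never belongs to a crossing family of size \<open>k + 2\<close>, so no
  family witnessing saturation uses \<open>v\<close>.\<close>

lemma saturated_remove:
  assumes W: "W \<subseteq> V" "saturated k X E W" and v: "v \<in> W"
    and nbrs: "\<And>u. u \<in> W \<Longrightarrow> u \<noteq> v \<Longrightarrow> {v, u} \<in> E \<Longrightarrow> near k \<rho> W v u"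
  shows "saturated k X E (W - {v})"
  unfolding saturated_def
proof (intro ballI impI)
  fix a b assume ab: "a \<in> W - {v}" "b \<in> W - {v}" "a \<noteq> b \<and> {a, b} \<notin> E"
  then obtain F where F: "F \<subseteq> induced_edges E W" "card F = k + 1" "pairwise X (insert {a, b} F)"
    using W(2) unfolding saturated_def by blast
  have finF: "finite F" using F(2) by (simp add: card_ge_0_finite)
  have "v \<notin> e" if "e \<in> F" for e
  proof
    assume "v \<in> e"
    have e: "e \<in> E" "e \<subseteq> W" "card e = 2"
      using F(1) that edgeD by (auto simp: induced_edges_def)
    then obtain u where u: "e = {v, u}" "u \<noteq> v"
      using \<open>v \<in> e\<close> by (metis card_2_iff insert_iff insert_commute singletonD)
    \<comment> \<open>The roles are exchanged: \<open>e\<close> becomes the distinguished edge of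
      the same family, and \<open>{a, b}\<close> joins the other edges crossing it.\<close>
    let ?F = "insert {a, b} (F - {e})"
    have "{a, b} \<notin> F" using ab F(1) by (auto simp: induced_edges_def)
    then have "card ?F = k + 1"
      using finF F(2) that by simp
    moreover have "insert e ?F = insert {a, b} F" "e \<notin> ?F" using that \<open>{a, b} \<notin> F\<close> by auto
    moreover have "f \<subseteq> W \<and> card f = 2" if "f \<in> ?F" for f
      using that ab F(1) edgeD by (auto simp: induced_edges_def)
    ultimately have "\<not> near k \<rho> W v u"
      using crossing_family_not_near[of W v u ?F k] W v e u F(3) by auto
    then show False using nbrs[of u] e u by auto
  qed
  then have "F \<subseteq> induced_edges E (W - {v})"
    using F(1) by (auto simp: induced_edges_def)
  then show "\<exists>F \<subseteq> induced_edges E (W - {v}). card F = k + 1 \<and> pairwise X (insert {a, b} F)"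
    using F by blast
qed

text \<open>Lengths increase in the order of deletion, so the vertices still present when
  \<open>a\<close> is deleted are those at least as long as \<open>a\<close>. Degeneracy of the
  induced subgraph supplies the next vertex to delete.\<close>

lemma elimination_lengths:
  assumes "degenerate_graph (2 * k + 2) V E" "W \<subseteq> V" "saturated k X E W"
  shows "\<exists>len :: 'a \<Rightarrow> real. inj_on len W \<and> (\<forall>v\<in>W. len v > 0) \<and>
    (\<forall>a\<in>W. \<forall>b\<in>W. len a < len b \<longrightarrow>
      ({a, b} \<in> E \<longleftrightarrow> near k \<rho> {v \<in> W. len a \<le> len v} a b))"
  using assms(2,3)
proof (induction "card W" arbitrary: W)
  case 0
  then have "W = {}"
    using graph by (metis card_0_eq finite_subset simple_graph_def)
  then show ?case by simp
next
  case (Suc n)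
  have "subgraph_of W (induced_edges E W) V E"
    using Suc.prems by (auto simp: subgraph_of_def induced_edges_def)
  moreover have "W \<noteq> {}" using Suc.hyps(2) by auto
  ultimately obtain v where v: "v \<in> W" "graph_degree (induced_edges E W) v \<le> 2 * k + 2"
    using assms(1) unfolding degenerate_graph_def by blast
  have nbrs: "near k \<rho> W v u" if "u \<in> W" "u \<noteq> v" "{v, u} \<in> E" for u
    using low_degree_near[OF Suc.prems v] that by blast
  have "saturated k X E (W - {v})"
    using saturated_remove[OF Suc.prems v(1)] nbrs by blast
  moreover have "n = card (W - {v})" "W - {v} \<subseteq> V"
    using Suc.hyps(2) v(1) Suc.prems by auto
  ultimately have "\<exists>len' :: 'a \<Rightarrow> real. inj_on len' (W - {v}) \<and> (\<forall>x\<in>W - {v}. len' x > 0) \<and>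
      (\<forall>a\<in>W - {v}. \<forall>b\<in>W - {v}. len' a < len' b \<longrightarrow>
        ({a, b} \<in> E \<longleftrightarrow> near k \<rho> {x \<in> W - {v}. len' a \<le> len' x} a b))"
    by (rule Suc.hyps(1)[rotated 2])
  then obtain len' :: "'a \<Rightarrow> real" where len':
    "inj_on len' (W - {v})" "\<forall>x\<in>W - {v}. len' x > 0"
    "\<And>a b. a \<in> W - {v} \<Longrightarrow> b \<in> W - {v} \<Longrightarrow> len' a < len' b \<Longrightarrow>
      {a, b} \<in> E \<longleftrightarrow> near k \<rho> {x \<in> W - {v}. len' a \<le> len' x} a b"
    by blast
  \<comment> \<open>The shift by 1 makes \<open>v\<close> the shortest and keeps the order of the
    others, so their sets of at least as long vertices are unchanged and omit
    \<open>v\<close>.\<close>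
  define len where "len x = (if x = v then 1 else len' x + 1)" for x
  have len_v: "len v < len x" if "x \<in> W" "x \<noteq> v" for x
    using len'(2) that by (simp add: len_def)
  have "inj_on len W"
  proof (rule inj_onI)
    fix x y assume "x \<in> W" "y \<in> W" "len x = len y"
    then show "x = y"
      using len_v[of x] len_v[of y] inj_onD[OF len'(1), of x y]
      by (cases "x = v"; cases "y = v") (auto simp: len_def)
  qed
  moreover have "\<forall>x\<in>W. len x > 0" using len'(2) by (force simp: len_def)
  moreover have "{a, b} \<in> E \<longleftrightarrow> near k \<rho> {x \<in> W. len a \<le> len x} a b"
    if ab: "a \<in> W" "b \<in> W" "len a < len b" for a b
  proof (cases "a = v")
    case True
    have "{x \<in> W. len v \<le> len x} = W" using len_v by (force intro: less_imp_le)
    moreover have "b \<noteq> v" using ab True by auto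
    ultimately show ?thesis
      using True ab nbrs[of b] near_adjacent[OF Suc.prems v(1), of b] by auto
  next
    case False
    then have "b \<noteq> v" using ab len_v[of a] by auto
    moreover have "{x \<in> W. len a \<le> len x} = {x \<in> W - {v}. len' a \<le> len' x}"
      using False len_v[of a] ab(1) by (auto simp: len_def)
    ultimately show ?thesis
      using False ab len'(3)[of a b] by (simp add: len_def)
  qed
  ultimately show ?case by blast
qed

end

section \<open>Visibility between semi-bars\<close>

text \<open>For arguments in \<open>{0..<2 * pi}\<close> this is \<open>y - x\<close> reduced modulo
  \<open>2 * pi\<close> to the same interval.\<close>

definition turn :: "real \<Rightarrow> real \<Rightarrow> real" where
  "turn x y = (if x \<le> y then y - x else y - x + 2 * pi)"

definition circle_point :: "real \<Rightarrow> real \<Rightarrow> real^3" where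
  "circle_point c t = vector [c, cos t, sin t]"

section \<open>Semi-bars and arcs in cylindrical coordinates\<close>

lemma circle_point_eq_iff:
  "circle_point c t = circle_point c' t' \<longleftrightarrow> c = c' \<and> (\<exists>n::int. t = t' + 2 * pi * n)"
  using sin_cos_eq_iff[of t t']
  by (auto simp: circle_point_def vec_eq_iff forall_3)

lemma semi_bar_circle_point:
  assumes "l \<ge> 0"
  shows "semi_bar (circle_point 0 t) l = (\<lambda>c. circle_point c t) ` {0..l}"
proof -
  have shift: "circle_point 0 t + (u * l) *\<^sub>R vector [1, 0, 0] = circle_point (u * l) t" for u
    by (simp add: circle_point_def vec_eq_iff forall_3)
  have "semi_bar (circle_point 0 t) l =
      (\<lambda>u. circle_point 0 t + (u * l) *\<^sub>R vector [1, 0, 0]) ` {0..1}"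
    unfolding semi_bar_def closed_segment_def by (auto simp: algebra_simps image_iff)
  also have "\<dots> = (\<lambda>c. circle_point c t) ` (\<lambda>u. u * l) ` {0..1}"
    by (simp only: shift image_image)
  also have "(\<lambda>u. u * l) ` {0..1} = {0..l}"
    using assms by (simp add: image_mult_atLeastAtMost_if')
  finally show ?thesis .
qed

lemma arc_meets_semi_bar:
  assumes "l \<ge> 0"
  shows "circle_point c ` {\<alpha>..\<beta>} \<inter> semi_bar (circle_point 0 x) l \<noteq> {} \<longleftrightarrow>
    0 \<le> c \<and> c \<le> l \<and> (\<exists>n::int. \<alpha> \<le> x + 2 * pi * n \<and> x + 2 * pi * n \<le> \<beta>)"
  (is "?L \<longleftrightarrow> ?R")
proof
  assume ?L
  then show ?R
    unfolding semi_bar_circle_point[OF assms] by (auto simp: circle_point_eq_iff)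
next
  assume ?R
  then obtain n :: int where n: "0 \<le> c" "c \<le> l" "\<alpha> \<le> x + 2 * pi * n" "x + 2 * pi * n \<le> \<beta>"
    by blast
  have "circle_point c (x + 2 * pi * n) = circle_point c x" by (auto simp: circle_point_eq_iff)
  then have "circle_point c x \<in> circle_point c ` {\<alpha>..\<beta>} \<inter> semi_bar (circle_point 0 x) l"
    unfolding semi_bar_circle_point[OF assms] using n
    by (auto intro: rev_image_eqI[of "x + 2 * pi * n"])
  then show ?L by blast
qed


section \<open>Turning angles modulo a full turn\<close>

lemma turn_bounds:
  assumes "x \<in> {0..<2 * pi}" "y \<in> {0..<2 * pi}"
  shows "0 \<le> turn x y" "turn x y < 2 * pi" "turn x y = 0 \<longleftrightarrow> x = y"
  using assms by (auto simp: turn_def)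

lemma turn_cong: "\<exists>n::int. x + turn x y = y + 2 * pi * n"
proof (cases "x \<le> y")
  case True
  then show ?thesis by (intro exI[of _ 0]) (simp add: turn_def)
next
  case False
  then show ?thesis by (intro exI[of _ 1]) (simp add: turn_def)
qed

lemma turn_eqI:
  assumes "x \<in> {0..<2 * pi}" "y \<in> {0..<2 * pi}" "0 \<le> t" "t < 2 * pi"
    and "x + t = y + 2 * pi * real_of_int n"
  shows "t = turn x y"
proof -
  obtain m :: int where m: "x + turn x y = y + 2 * pi * m" using turn_cong by blast
  have "t - turn x y = 2 * pi * real_of_int (n - m)"
    using m assms(5) by (simp add: algebra_simps)
  moreover have "\<bar>t - turn x y\<bar> < 2 * pi"
    using turn_bounds[OF assms(1,2)] assms(3,4) by linarith
  ultimately have "2 * pi * \<bar>real_of_int (n - m)\<bar> < 2 * pi * 1"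
    by (simp add: abs_mult)
  then have "\<bar>real_of_int (n - m)\<bar> < 1" using pi_gt_zero by simp
  then have "n - m = 0" by linarith
  then show ?thesis using \<open>t - turn x y = 2 * pi * real_of_int (n - m)\<close> by simp
qed

text \<open>An arc meeting both semi-bars lies at some \<open>c\<close> with
  \<open>c \<le> len a\<close>, so within its angular range it meets every semi-bar at least as long
  as that of \<open>a\<close>, and it covers one of the two sides. Conversely, an arc at
  \<open>len a\<close> along the sparser side meets no shorter semi-bars.\<close>

lemma visible_iff_near:
  fixes \<theta> len :: "'a \<Rightarrow> real"
  assumes fin: "finite V" and inj: "inj_on \<theta> V"
    and range: "\<And>v. v \<in> V \<Longrightarrow> \<theta> v \<in> {0..<2 * pi}" and pos: "\<And>v. v \<in> V \<Longrightarrow> len v > 0"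
    and ab: "a \<in> V" "b \<in> V" "a \<noteq> b" "len a \<le> len b"
  shows "visible k V (\<lambda>v. semi_bar (circle_point 0 (\<theta> v)) (len v)) a b \<longleftrightarrow>
    near k (\<lambda>x y. turn (\<theta> x) (\<theta> y)) {v \<in> V. len a \<le> len v} a b"
    (is "visible k V ?s a b \<longleftrightarrow> near k ?\<rho> ?W a b")
proof -
  let ?C = "{y \<in> ?W. 0 < ?\<rho> a y \<and> ?\<rho> a y < ?\<rho> a b}"
  let ?D = "{y \<in> ?W. ?\<rho> a b < ?\<rho> a y}"
  have meets: "circle_point c ` {\<alpha>..\<beta>} \<inter> ?s v \<noteq> {} \<longleftrightarrow>
      0 \<le> c \<and> c \<le> len v \<and> (\<exists>n::int. \<alpha> \<le> \<theta> v + 2 * pi * n \<and> \<theta> v + 2 * pi * n \<le> \<beta>)"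
    if "v \<in> V" for v c \<alpha> \<beta>
    using arc_meets_semi_bar pos[OF that] by simp
  have bounds: "0 \<le> ?\<rho> a v" "?\<rho> a v < 2 * pi" "?\<rho> a v = 0 \<longleftrightarrow> v = a" if "v \<in> V" for v
    using turn_bounds range that ab(1) inj by (auto dest: inj_onD)
  have rho_inj: "u = v" if "u \<in> V" "v \<in> V" "?\<rho> a u = ?\<rho> a v" for u v
    using that range[of u] range[of v] range[OF ab(1)] inj_onD[OF inj _ that(1,2)]
    by (auto simp: turn_def split: if_splits)
  have b_pos: "0 < ?\<rho> a b" using bounds[OF ab(2)] ab(3) by auto
  show ?thesis
  proof
    assume "visible k V ?s a b"
    then obtain A where A: "circular_arc A" "A \<inter> ?s a \<noteq> {}" "A \<inter> ?s b \<noteq> {}"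
      "card {v \<in> V - {a, b}. A \<inter> ?s v \<noteq> {}} \<le> k"
      unfolding visible_def by blast
    then obtain c \<alpha> \<beta> where arc: "\<beta> \<le> \<alpha> + 2 * pi" "A = circle_point c ` {\<alpha>..\<beta>}"
      unfolding circular_arc_def circle_point_def by blast
    obtain m n :: int where
      m: "0 \<le> c" "c \<le> len a" "\<alpha> \<le> \<theta> a + 2 * pi * m" "\<theta> a + 2 * pi * m \<le> \<beta>" and
      n: "\<alpha> \<le> \<theta> b + 2 * pi * n" "\<theta> b + 2 * pi * n \<le> \<beta>"
      using A(2,3) meets[OF ab(1)] meets[OF ab(2)] unfolding arc(2) by blast
    define s t where "s = \<theta> a + 2 * pi * m" and "t = \<theta> b + 2 * pi * n"
    have st: "\<alpha> \<le> s" "s \<le> \<beta>" "\<alpha> \<le> t" "t \<le> \<beta>" using m n by (simp_all add: s_def t_def)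
    \<comment> \<open>Angles are measured from the lift \<open>s\<close> of the angle of
      \<open>a\<close>; the integer \<open>i\<close> is needed for arcs that reach \<open>b\<close>
      backwards.\<close>
    have hit: "A \<inter> ?s v \<noteq> {}" if v: "v \<in> ?W" "\<alpha> \<le> s + ?\<rho> a v + 2 * pi * real_of_int i"
      "s + ?\<rho> a v + 2 * pi * real_of_int i \<le> \<beta>" for v i
    proof -
      obtain j :: int where "\<theta> a + ?\<rho> a v = \<theta> v + 2 * pi * j" using turn_cong by blast
      then have "s + ?\<rho> a v + 2 * pi * i = \<theta> v + 2 * pi * real_of_int (m + i + j)"
        by (simp add: s_def algebra_simps)
      then have "\<exists>n::int. \<alpha> \<le> \<theta> v + 2 * pi * n \<and> \<theta> v + 2 * pi * n \<le> \<beta>"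
        using v(2,3) by (intro exI[of _ "m + i + j"]) linarith
      moreover have "v \<in> V" "c \<le> len v" using v(1) m(2) by auto
      ultimately show ?thesis using meets m(1) unfolding arc(2) by blast
    qed
    obtain j :: int where "\<theta> a + ?\<rho> a b = \<theta> b + 2 * pi * j" using turn_cong by blast
    then have ts: "t - s = ?\<rho> a b + 2 * pi * real_of_int (n - m - j)"
      by (simp add: s_def t_def algebra_simps)
    have fin': "finite {v \<in> V - {a, b}. A \<inter> ?s v \<noteq> {}}" using fin by simp
    show "near k ?\<rho> ?W a b"
    proof (cases "s \<le> t")
      case True
      \<comment> \<open>As \<open>?\<rho> a b\<close> lies strictly between 0 and a full turn, this
        also holds when the arc is the full circle.\<close>
      have "n - m - j = 0"
      proof -
        have "0 \<le> t - s" "t - s \<le> 2 * pi" using True st arc(1) by auto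
        then have "2 * pi * real_of_int (n - m - j) > 2 * pi * (-1)"
          "2 * pi * real_of_int (n - m - j) < 2 * pi * 1"
          using ts b_pos bounds[OF ab(2)] by linarith+
        then have "real_of_int (n - m - j) > -1" "real_of_int (n - m - j) < 1"
          unfolding mult_less_cancel_left_pos[OF mult_pos_pos[OF zero_less_numeral pi_gt_zero]] .
        then show ?thesis by linarith
      qed
      then have "t = s + ?\<rho> a b" using ts by simp
      then have "?C \<subseteq> {v \<in> V - {a, b}. A \<inter> ?s v \<noteq> {}}"
        using st hit[of _ 0] bounds(3)[OF ab(1)] by auto
      then have "card ?C \<le> k" using card_mono[OF fin'] A(4) le_trans by blast
      then show ?thesis by (simp add: near_def)
    next
      case False
      \<comment> \<open>Here the arc runs from \<open>b\<close> forward to \<open>a\<close>, so it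
        covers the vertices of \<open>?D\<close>, lifted one turn back.\<close>
      have "n - m - j = -1"
      proof -
        have "t - s < 0" "t - s \<ge> - 2 * pi" using False st arc(1) by auto
        then have "2 * pi * real_of_int (n - m - j) > 2 * pi * (-2)"
          "2 * pi * real_of_int (n - m - j) < 2 * pi * 0"
          using ts b_pos bounds[OF ab(2)] by linarith+
        then have "real_of_int (n - m - j) > -2" "real_of_int (n - m - j) < 0"
          unfolding mult_less_cancel_left_pos[OF mult_pos_pos[OF zero_less_numeral pi_gt_zero]] .
        then show ?thesis by linarith
      qed
      then have "t = s + ?\<rho> a b - 2 * pi" using ts by simp
      then have "A \<inter> ?s v \<noteq> {}" if "v \<in> ?D" for v
        using st hit[of v "-1"] bounds(2)[of v] that by auto
      then have "?D \<subseteq> {v \<in> V - {a, b}. A \<inter> ?s v \<noteq> {}}"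
        using b_pos bounds(3)[OF ab(1)] by auto
      then have "card ?D \<le> k" using card_mono[OF fin'] A(4) le_trans by blast
      then show ?thesis by (simp add: near_def)
    qed
  next
    \<comment> \<open>Treats both sides at once: \<open>\<alpha>\<close> and \<open>\<beta>\<close>
      are angles relative to \<open>a\<close>, and \<open>Y\<close> bounds the vertices that the arc
      may meet besides \<open>a\<close> and \<open>b\<close>.\<close>
    have vis: "visible k V ?s a b"
      if "\<alpha> < \<beta>" "0 \<le> \<alpha>" "\<beta> \<le> 2 * pi" "Y \<subseteq> V" "card Y \<le> k"
        "\<alpha> = 0 \<and> \<beta> = ?\<rho> a b \<or> \<alpha> = ?\<rho> a b \<and> \<beta> = 2 * pi"
        "\<And>v. v \<in> ?W \<Longrightarrow> v \<noteq> a \<Longrightarrow> v \<noteq> b \<Longrightarrow> \<alpha> \<le> ?\<rho> a v \<Longrightarrow> ?\<rho> a v \<le> \<beta> \<Longrightarrow> v \<in> Y"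
      for \<alpha> \<beta> Y
    proof -
      define A where "A = circle_point (len a) ` {\<theta> a + \<alpha>..\<theta> a + \<beta>}"
      have "circular_arc A"
        unfolding circular_arc_def A_def circle_point_def
        using that(1-3) by (intro exI[of _ "len a"] exI[of _ "\<theta> a + \<alpha>"] exI[of _ "\<theta> a + \<beta>"]) auto
      moreover have "A \<inter> ?s a \<noteq> {}"
      proof -
        \<comment> \<open>The arc starts at \<open>a\<close> in the first case
          (\<open>n = 0\<close>) and ends there after a full turn in the second
          (\<open>n = 1\<close>).\<close>
        have "\<exists>n::int. \<theta> a + \<alpha> \<le> \<theta> a + 2 * pi * n \<and> \<theta> a + 2 * pi * n \<le> \<theta> a + \<beta>"
          using that(6) b_pos bounds(2)[OF ab(2)]
          by (elim disjE) (intro exI[of _ 0] exI[of _ 1]; simp; fail)+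
        then show ?thesis using meets[OF ab(1)] pos[OF ab(1)] unfolding A_def by simp
      qed
      moreover have "A \<inter> ?s b \<noteq> {}"
      proof -
        obtain n :: int where "\<theta> a + ?\<rho> a b = \<theta> b + 2 * pi * n" using turn_cong by blast
        then have "\<exists>n::int. \<theta> a + \<alpha> \<le> \<theta> b + 2 * pi * n \<and> \<theta> b + 2 * pi * n \<le> \<theta> a + \<beta>"
          using that(1,6) by (intro exI[of _ n]) auto
        then show ?thesis using meets[OF ab(2)] pos[OF ab(1)] ab(4) unfolding A_def by simp
      qed
      moreover have "{v \<in> V - {a, b}. A \<inter> ?s v \<noteq> {}} \<subseteq> Y"
      proof
        fix v assume v: "v \<in> {v \<in> V - {a, b}. A \<inter> ?s v \<noteq> {}}"
        then obtain n :: int where n: "len a \<le> len v"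
          "\<theta> a + \<alpha> \<le> \<theta> v + 2 * pi * n" "\<theta> v + 2 * pi * n \<le> \<theta> a + \<beta>"
          using meets[of v] unfolding A_def by auto
        have vV: "v \<in> V" using v by blast
        define t where "t = \<theta> v + 2 * pi * n - \<theta> a"
        have t: "\<alpha> \<le> t" "t \<le> \<beta>" "\<theta> a + t = \<theta> v + 2 * pi * n" using n by (auto simp: t_def)
        \<comment> \<open>After a full turn the arc is back at \<open>a\<close>, where no other
          semi-bar is placed; so \<open>t\<close> lies in the half-open range required by
          \<open>turn_eqI\<close>.\<close>
        have "t \<noteq> 2 * pi"
        proof
          assume "t = 2 * pi"
          then have "\<theta> a + 0 = \<theta> v + 2 * pi * real_of_int (n - 1)"
            using t(3) by (simp add: algebra_simps)
          then have "0 = ?\<rho> a v"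
            by (intro turn_eqI[OF range[OF ab(1)] range[OF vV], where n = "n - 1"])
              (use pi_gt_zero in auto)
          then show False using bounds(3)[OF vV] v by simp
        qed
        then have "t = ?\<rho> a v"
          using turn_eqI[OF range[OF ab(1)] range[OF vV] _ _ t(3)] t(1,2) that(2,3) by linarith
        then show "v \<in> Y" using that(7)[of v] v n(1) t by auto
      qed
      then have "card {v \<in> V - {a, b}. A \<inter> ?s v \<noteq> {}} \<le> k"
        using card_mono[OF finite_subset[OF that(4) fin]] that(5) le_trans by blast
      ultimately show ?thesis unfolding visible_def by blast
    qed
    assume "near k ?\<rho> ?W a b"
    then consider "card ?C \<le> k" | "card ?D \<le> k" unfolding near_def by blast
    then show "visible k V ?s a b"
    proof cases
      case 1
      have "v \<in> ?C" if "v \<in> ?W" "v \<noteq> a" "v \<noteq> b" "?\<rho> a v \<le> ?\<rho> a b" for v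
        using that bounds[of v] rho_inj[of v b] ab(2) by fastforce
      then show ?thesis using 1 b_pos bounds[OF ab(2)] by (intro vis[of 0 "?\<rho> a b" ?C]) auto
    next
      case 2
      have "v \<in> ?D" if "v \<in> ?W" "v \<noteq> a" "v \<noteq> b" "?\<rho> a b \<le> ?\<rho> a v" for v
        using that rho_inj[of v b] ab(2) by fastforce
      then show ?thesis
        using 2 b_pos bounds[OF ab(2)] by (intro vis[of "?\<rho> a b" "2 * pi" ?D]) auto
    qed
  qed
qed

lemma visible_commute: "visible k V s a b \<longleftrightarrow> visible k V s b a"
  unfolding visible_def insert_commute[of a b "{}"] by blast

section \<open>From maximal quasiplanar drawings to semi-bars\<close>

text \<open>A crossing family created by adding \<open>{u, v}\<close> must contain
  \<open>{u, v}\<close>, since \<open>E\<close> alone has none; the other \<open>k + 1\<close> edges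
  are the witness.\<close>

lemma maximal_rep_saturated:
  assumes graph: "simple_graph V E" and max: "maximal_quasiplanar_convex_rep (k + 2) V E p"
  shows "saturated k (crossing p) E V"
  unfolding saturated_def
proof (intro ballI impI)
  fix u v assume uv: "u \<in> V" "v \<in> V" "u \<noteq> v \<and> {u, v} \<notin> E"
  then obtain G where G: "G \<subseteq> insert {u, v} E" "finite G" "card G = k + 2"
      "pairwise (crossing p) G"
    using max unfolding maximal_quasiplanar_convex_rep_def has_pairwise_crossing_def by blast
  have "{u, v} \<in> G"
    using G max unfolding maximal_quasiplanar_convex_rep_def quasiplanar_convex_rep_def
      has_pairwise_crossing_def by blast
  then have "insert {u, v} (G - {{u, v}}) = G" "card (G - {{u, v}}) = k + 1"
    using G(2,3) by auto
  moreover have "G - {{u, v}} \<subseteq> induced_edges E V"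
    using G(1) graph by (auto simp: induced_edges_def simple_graph_def)
  ultimately show "\<exists>F \<subseteq> induced_edges E V. card F = k + 1 \<and>
      pairwise (crossing p) (insert {u, v} F)"
    using G(4) by metis
qed

theorem theorem9:
  fixes k :: nat and V :: "'a set" and E :: "'a set set"
  assumes "simple_graph V E"
    and "degenerate_graph (2 * k + 2) V E"
    and "\<exists>p. maximal_quasiplanar_convex_rep (k + 2) V E p"
  shows "\<exists>q len. cyl_semi_bar_visibility_rep k V E q len \<and> inj_on len V"
proof -
  obtain p where p: "maximal_quasiplanar_convex_rep (k + 2) V E p" using assms(3) by blast
  have fin: "finite V" using assms(1) by (simp add: simple_graph_def)
  have pV: "inj_on p V" "convex_position (p ` V)"
    using p by (auto simp: maximal_quasiplanar_convex_rep_def quasiplanar_convex_rep_def)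
  obtain f :: "real^2 \<Rightarrow> real" where f: "inj_on f (p ` V)"
    "\<forall>x\<in>p ` V. \<forall>y\<in>p ` V. \<forall>z\<in>p ` V. f x < f y \<and> f y < f z \<longrightarrow> orient x y z > 0"
    using convex_position_order[OF _ pV(2)] fin by blast
  \<comment> \<open>Increasing in \<open>f (p v)\<close> with values strictly between 0 and
    \<open>2 * pi\<close>: the linear order becomes a placement on the circle.\<close>
  define \<theta> where "\<theta> v = pi + 2 * arctan (f (p v))" for v
  have range: "\<theta> v \<in> {0..<2 * pi}" for v
    using arctan_bounded[of "f (p v)"] by (auto simp: \<theta>_def)
  have inj: "inj_on \<theta> V"
    using pV(1) f(1) by (auto simp: inj_on_def \<theta>_def arctan_eq_iff)
  have less: "\<theta> u < \<theta> v \<longleftrightarrow> f (p u) < f (p v)" for u v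
    by (simp add: \<theta>_def arctan_less_iff)
  define \<rho> where "\<rho> x y = turn (\<theta> x) (\<theta> y)" for x y
  \<comment> \<open>Alternation in the linear order is translated into alternation seen from
    \<open>a\<close>. If \<open>b\<close> precedes \<open>a\<close>, turning from \<open>a\<close>
    to \<open>b\<close> passes through the outer endpoint, so \<open>c\<close> and \<open>d\<close>
    exchange roles in \<open>gt\<close>.\<close>
  have lt: "0 < \<rho> a c \<and> \<rho> a c < \<rho> a b \<and> \<rho> a b < \<rho> a d"
    if "\<theta> a < \<theta> b" "\<theta> a < \<theta> c" "\<theta> c < \<theta> b" "\<theta> d < \<theta> a \<or> \<theta> b < \<theta> d" for a b c d
    using that range[of a] range[of b] range[of c] range[of d] by (auto simp: \<rho>_def turn_def)
  have gt: "0 < \<rho> a d \<and> \<rho> a d < \<rho> a b \<and> \<rho> a b < \<rho> a c"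
    if "\<theta> b < \<theta> a" "\<theta> b < \<theta> c" "\<theta> c < \<theta> a" "\<theta> d < \<theta> b \<or> \<theta> a < \<theta> d" for a b c d
    using that range[of a] range[of b] range[of c] range[of d] by (auto simp: \<rho>_def turn_def)
  interpret cyclic_crossing V E \<rho> "crossing p"
  proof
    show "simple_graph V E" by fact
    show "\<rho> a a = 0" for a by (simp add: \<rho>_def turn_def)
    fix e g a b
    assume *: "crossing p e g" "e \<subseteq> V" "g \<subseteq> V" "card e = 2" "card g = 2" "e = {a, b}"
    have inter: "\<exists>c d. g = {c, d} \<and> \<theta> x < \<theta> c \<and> \<theta> c < \<theta> y \<and> (\<theta> d < \<theta> x \<or> \<theta> y < \<theta> d)"
      if "e = {x, y}" "\<theta> x < \<theta> y" for x y
      using f(2) less by (intro crossing_interleaved[OF inj _ *(1-3,5) that]) auto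
    have "a \<noteq> b" using *(4,6) by auto
    then have "\<theta> a \<noteq> \<theta> b" using inj *(2,6) by (auto dest: inj_onD)
    then consider "\<theta> a < \<theta> b" | "\<theta> b < \<theta> a" by linarith
    then show "\<exists>c d. g = {c, d} \<and> 0 < \<rho> a c \<and> \<rho> a c < \<rho> a b \<and> \<rho> a b < \<rho> a d"
    proof cases
      case 1
      then show ?thesis using inter[of a b] *(6) lt by meson
    next
      case 2
      moreover have "e = {b, a}" using *(6) by auto
      ultimately obtain c d where "g = {c, d}" "\<theta> b < \<theta> c" "\<theta> c < \<theta> a" "\<theta> d < \<theta> b \<or> \<theta> a < \<theta> d"
        using inter[of b a] by blast
      then show ?thesis using gt[OF 2] by (intro exI[of _ d] exI[of _ c]) auto
    qed
  qed
  obtain len :: "'a \<Rightarrow> real" where len: "inj_on len V" "\<And>v. v \<in> V \<Longrightarrow> len v > 0"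
    "\<And>a b. a \<in> V \<Longrightarrow> b \<in> V \<Longrightarrow> len a < len b \<Longrightarrow>
      {a, b} \<in> E \<longleftrightarrow> near k \<rho> {v \<in> V. len a \<le> len v} a b"
    using elimination_lengths[OF assms(2) order_refl maximal_rep_saturated[OF assms(1) p]]
    by blast
  define s where "s v = semi_bar (circle_point 0 (\<theta> v)) (len v)" for v
  have adj: "{a, b} \<in> E \<longleftrightarrow> visible k V s a b" if "a \<in> V" "b \<in> V" "len a < len b" for a b
  proof -
    have "a \<noteq> b" "len a \<le> len b" using that(3) by auto
    then have "visible k V s a b \<longleftrightarrow> near k \<rho> {v \<in> V. len a \<le> len v} a b"
      unfolding s_def[abs_def] \<rho>_def[abs_def]
      using range len(2) by (intro visible_iff_near[OF fin inj _ _ that(1,2)])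
    then show ?thesis using len(3)[OF that] by simp
  qed
  have "{a, b} \<in> E \<longleftrightarrow> visible k V s a b" if "a \<in> V" "b \<in> V" "a \<noteq> b" for a b
  proof -
    \<comment> \<open>Lengths differ, so \<open>adj\<close> applies from the shorter of the two;
      visibility is symmetric.\<close>
    have "len a < len b \<or> len b < len a" using len(1) that by (metis inj_onD linorder_neq_iff)
    then show ?thesis
      using adj[of a b] adj[of b a] that visible_commute[of k V s a b]
      by (auto simp: insert_commute)
  qed
  moreover have "circle_point 0 (\<theta> v) \<in> base_circle" for v
    unfolding base_circle_def circle_point_def using sin_cos_squared_add2 by blast
  moreover have "disjnt (s u) (s v)" if uv: "u \<in> V" "v \<in> V" "u \<noteq> v" for u v
  proof (rule ccontr)
    assume "\<not> disjnt (s u) (s v)"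
    then obtain n :: int where "\<theta> u + 0 = \<theta> v + 2 * pi * n"
      using len(2)[OF uv(1)] len(2)[OF uv(2)]
      by (auto simp: disjnt_iff s_def semi_bar_circle_point circle_point_eq_iff)
    then have "0 = turn (\<theta> u) (\<theta> v)"
      by (intro turn_eqI[OF range range]) simp_all
    then show False using turn_bounds(3)[OF range range] inj uv by (auto dest: inj_onD)
  qed
  ultimately have "cyl_semi_bar_visibility_rep k V E (\<lambda>v. circle_point 0 (\<theta> v)) len"
    using len(2) unfolding cyl_semi_bar_visibility_rep_def s_def[abs_def]
    by (simp add: pairwise_def)
  then show ?thesis using len(1) by blast
qed

end
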